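(* Let $n>5$. In the $1:1$ PathWalker-Breaker game played on the complete graph $K_n$, under optimal play by both players (regardless of which player moves first), PathWalker visits exactly $n-2$ vertices, i.e. all but two vertices.
   Context: The $1:\beta$ PathWalker-Breaker game on a graph $G$: two players, (Path)Walker and Breaker, alternate turns. Walker is positioned at a vertex of $G$ (her initial vertex counts as visited). On her turn she moves from her current vertex $v$ along an edge $e=vw$ of $G$ that has not been acquired by Breaker and such that $w$ has not previously been visited by her; she thereby acquires $e$ and visits $w$. On his turn Breaker acquires $\beta$ edges of $G$ not already acquired by either player. The game ends when there is no path from Walker's current position to an unvisited vertex using only edges not acquired by Breaker and (apart from the current position) only previously unvisited vertices. Walker wants to maximize, and Breaker to minimize, the number of vertices Walker visits. Here $\beta=1$. *)

theory Defs
  imports Main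
begin

text \<open>A simple graph is a pair of a vertex set and a set of edges, an edge being a two-element
  set of vertices.\<close>

type_synonym 'a graph = "'a set \<times> 'a set set"

abbreviation verts :: "'a graph \<Rightarrow> 'a set" where "verts \<equiv> fst"

abbreviation edges :: "'a graph \<Rightarrow> 'a set set" where "edges \<equiv> snd"

definition complete_graph :: "nat \<Rightarrow> nat graph" where
  "complete_graph n = ({..<n}, {e. e \<subseteq> {..<n} \<and> card e = 2})"

datatype player = Walker | Breaker

record 'a position =
  location :: 'a
  visited :: "'a set"
  walker_edges :: "'a set set"
  breaker_edges :: "'a set set"
  to_move :: player

definition start_position :: "player \<Rightarrow> 'a \<Rightarrow> 'a position" where
  "start_position first v =
     \<lparr>location = v, visited = {v}, walker_edges = {}, breaker_edges = {}, to_move = first\<rparr>"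

definition walker_move :: "'a graph \<Rightarrow> 'a position \<Rightarrow> 'a position \<Rightarrow> bool" where
  "walker_move G p q \<longleftrightarrow>
     (\<exists>w \<in> verts G. {location p, w} \<in> edges G \<and> {location p, w} \<notin> breaker_edges p \<and>
        w \<notin> visited p \<and>
        q = p\<lparr>location := w, visited := insert w (visited p),
              walker_edges := insert {location p, w} (walker_edges p), to_move := Breaker\<rparr>)"

definition free_edges :: "'a graph \<Rightarrow> 'a position \<Rightarrow> 'a set set" where
  "free_edges G p = edges G - (walker_edges p \<union> breaker_edges p)"

text \<open>The second disjunct, where Breaker takes all that is left, keeps the game defined when fewer
  than \<open>\<beta>\<close> edges are free.\<close>

definition breaker_move :: "'a graph \<Rightarrow> nat \<Rightarrow> 'a position \<Rightarrow> 'a position \<Rightarrow> bool" where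
  "breaker_move G \<beta> p q \<longleftrightarrow>
     (\<exists>F \<subseteq> free_edges G p. finite F \<and> (card F = \<beta> \<or> card F < \<beta> \<and> F = free_edges G p) \<and>
        q = p\<lparr>breaker_edges := breaker_edges p \<union> F, to_move := Walker\<rparr>)"

text \<open>The list \<open>us\<close> is the rest, after the current location, of a path ending in the unvisited
  vertex \<open>last us\<close>.\<close>

definition game_over :: "'a graph \<Rightarrow> 'a position \<Rightarrow> bool" where
  "game_over G p \<longleftrightarrow>
     \<not> (\<exists>us. us \<noteq> [] \<and> distinct (location p # us) \<and> set us \<subseteq> verts G - visited p \<and>
           successively (\<lambda>x y. {x, y} \<in> edges G - breaker_edges p) (location p # us))"

definition legal_move :: "'a graph \<Rightarrow> nat \<Rightarrow> 'a position \<Rightarrow> 'a position \<Rightarrow> bool" where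
  "legal_move G \<beta> p q \<longleftrightarrow> \<not> game_over G p \<and>
     (case to_move p of Walker \<Rightarrow> walker_move G p q | Breaker \<Rightarrow> breaker_move G \<beta> p q)"

definition partial_play :: "'a graph \<Rightarrow> nat \<Rightarrow> 'a position \<Rightarrow> 'a position list \<Rightarrow> bool" where
  "partial_play G \<beta> p\<^sub>0 ps \<longleftrightarrow> ps \<noteq> [] \<and> hd ps = p\<^sub>0 \<and> successively (legal_move G \<beta>) ps"

definition complete_play :: "'a graph \<Rightarrow> nat \<Rightarrow> 'a position \<Rightarrow> 'a position list \<Rightarrow> bool" where
  "complete_play G \<beta> p\<^sub>0 ps \<longleftrightarrow> partial_play G \<beta> p\<^sub>0 ps \<and> game_over G (last ps)"

text \<open>A strategy maps the history of the game, ending in the current position, to the next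
  position.\<close>

type_synonym 'a strategy = "'a position list \<Rightarrow> 'a position"

definition legal_strategy ::
  "'a graph \<Rightarrow> nat \<Rightarrow> 'a position \<Rightarrow> player \<Rightarrow> 'a strategy \<Rightarrow> bool" where
  "legal_strategy G \<beta> p\<^sub>0 A \<sigma> \<longleftrightarrow>
     (\<forall>ps. partial_play G \<beta> p\<^sub>0 ps \<and> to_move (last ps) = A \<and> \<not> game_over G (last ps) \<longrightarrow>
           legal_move G \<beta> (last ps) (\<sigma> ps))"

definition follows :: "player \<Rightarrow> 'a strategy \<Rightarrow> 'a position list \<Rightarrow> bool" where
  "follows A \<sigma> ps \<longleftrightarrow>
     (\<forall>i. Suc i < length ps \<and> to_move (ps ! i) = A \<longrightarrow> ps ! Suc i = \<sigma> (take (Suc i) ps))"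

definition walker_guarantees :: "'a graph \<Rightarrow> nat \<Rightarrow> 'a position \<Rightarrow> nat \<Rightarrow> bool" where
  "walker_guarantees G \<beta> p\<^sub>0 k \<longleftrightarrow>
     (\<exists>\<sigma>. legal_strategy G \<beta> p\<^sub>0 Walker \<sigma> \<and>
        (\<forall>ps. complete_play G \<beta> p\<^sub>0 ps \<and> follows Walker \<sigma> ps \<longrightarrow> k \<le> card (visited (last ps))))"

definition breaker_guarantees :: "'a graph \<Rightarrow> nat \<Rightarrow> 'a position \<Rightarrow> nat \<Rightarrow> bool" where
  "breaker_guarantees G \<beta> p\<^sub>0 k \<longleftrightarrow>
     (\<exists>\<tau>. legal_strategy G \<beta> p\<^sub>0 Breaker \<tau> \<and>
        (\<forall>ps. complete_play G \<beta> p\<^sub>0 ps \<and> follows Breaker \<tau> ps \<longrightarrow> card (visited (last ps)) \<le> k))"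

text \<open>Meant for finite graphs, where every play is finite: two legal strategies then determine
  exactly one complete play, so at most one \<open>k\<close> satisfies the following.\<close>

definition optimal_visits :: "'a graph \<Rightarrow> nat \<Rightarrow> player \<Rightarrow> 'a \<Rightarrow> nat \<Rightarrow> bool" where
  "optimal_visits G \<beta> first v k \<longleftrightarrow>
     walker_guarantees G \<beta> (start_position first v) k \<and>
     breaker_guarantees G \<beta> (start_position first v) k"

end

theory Submission
  imports Defs
begin

text \<open>Call a vertex open while it is unvisited. Walker ensures that before each of Breaker's moves
  no Breaker edge joins two open vertices and at most one Breaker edge joins her location to an open
  vertex. Whatever Breaker then adds, she can move to an end of the only Breaker edge between open
  vertices, if there is one. With three open vertices she is never stuck, as Breaker would need three
  edges at her location.

  Breaker plays arbitrarily until it is his turn with four open vertices, and then takes an edge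
  between two of them. After Walker's move there are three open vertices, and Breaker holds an edge
  inside these vertices and her location. He completes it to a perfect matching of these four
  vertices, so Walker can only move to an end of the matching edge not containing her. The other end
  is then blocked, and Breaker blocks the last open vertex.\<close>

section \<open>Strategies from invariants\<close>

lemma partial_play_snoc:
  assumes "ps \<noteq> []"
  shows "partial_play G \<beta> p\<^sub>0 (ps @ [q]) \<longleftrightarrow> partial_play G \<beta> p\<^sub>0 ps \<and> legal_move G \<beta> (last ps) q"
  using assms by (auto simp: partial_play_def successively_append_iff)

lemma follows_snoc:
  assumes "ps \<noteq> []"
  shows "follows A \<sigma> (ps @ [q]) \<longleftrightarrow> follows A \<sigma> ps \<and> (to_move (last ps) = A \<longrightarrow> q = \<sigma> ps)"
proof -
  \<comment> \<open>Appending \<open>q\<close> adds only the constraint at the last index of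
    \<open>ps\<close>.\<close>
  have len: "Suc i < length (ps @ [q]) \<longleftrightarrow> Suc i < length ps \<or> i = length ps - 1" for i
    using assms by (cases ps) auto
  show ?thesis
    unfolding follows_def len using assms
    by (auto simp: nth_append last_conv_nth)
qed

text \<open>The strategy looks only at the current position and picks a legal successor, one that
  keeps \<open>I\<close> whenever \<open>I\<close> holds. A legal strategy must also answer
  histories in which \<open>I\<close> has failed; \<open>ex\<close> serves these.\<close>

lemma invariant_strategy:
  assumes start: "I p\<^sub>0"
    and own: "\<And>p. I p \<Longrightarrow> to_move p = A \<Longrightarrow> \<not> game_over G p \<Longrightarrow> \<exists>q. legal_move G \<beta> p q \<and> I q"
    and other: "\<And>p q. I p \<Longrightarrow> to_move p \<noteq> A \<Longrightarrow> legal_move G \<beta> p q \<Longrightarrow> I q"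
    and ex: "\<And>p. to_move p = A \<Longrightarrow> \<not> game_over G p \<Longrightarrow> \<exists>q. legal_move G \<beta> p q"
  shows "\<exists>\<sigma>. legal_strategy G \<beta> p\<^sub>0 A \<sigma> \<and>
    (\<forall>ps. partial_play G \<beta> p\<^sub>0 ps \<and> follows A \<sigma> ps \<longrightarrow> I (last ps))"
proof -
  have "\<exists>q. to_move p = A \<and> \<not> game_over G p \<longrightarrow> legal_move G \<beta> p q \<and> (I p \<longrightarrow> I q)" for p
    using own ex by (cases "I p") blast+
  then obtain f where f: "\<And>p. to_move p = A \<Longrightarrow> \<not> game_over G p
      \<Longrightarrow> legal_move G \<beta> p (f p) \<and> (I p \<longrightarrow> I (f p))"
    by metis
  define \<sigma> where "\<sigma> ps = f (last ps)" for ps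
  have "I (last ps)" if "partial_play G \<beta> p\<^sub>0 ps" "follows A \<sigma> ps" for ps
    using that
  proof (induction ps rule: rev_induct)
    case Nil
    then show ?case by (simp add: partial_play_def)
  next
    case (snoc q ps)
    show ?case
    proof (cases "ps = []")
      case True
      with snoc.prems start show ?thesis by (simp add: partial_play_def)
    next
      case False
      with snoc have "I (last ps)" and move: "legal_move G \<beta> (last ps) q"
        and "to_move (last ps) = A \<longrightarrow> q = \<sigma> ps"
        by (auto simp: partial_play_snoc follows_snoc)
      then show ?thesis
        using f other[OF _ _ move] by (auto simp: legal_move_def \<sigma>_def)
    qed
  qed
  moreover have "legal_strategy G \<beta> p\<^sub>0 A \<sigma>"
    using f by (auto simp: legal_strategy_def \<sigma>_def)
  ultimately show ?thesis by blast
qed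

text \<open>A path witnessing that the game goes on starts with a legal step for Walker.\<close>

lemma walker_move_exists:
  assumes "\<not> game_over G p"
  shows "\<exists>q. walker_move G p q"
proof -
  from assms obtain us where us: "us \<noteq> []" "set us \<subseteq> verts G - visited p"
    "successively (\<lambda>x y. {x, y} \<in> edges G - breaker_edges p) (location p # us)"
    unfolding game_over_def by blast
  then obtain w ws where "us = w # ws" by (cases us) auto
  with us show ?thesis by (auto simp: walker_move_def)
qed

lemma breaker_move_exists: "\<exists>q. breaker_move G 1 p q"
proof (cases "free_edges G p = {}")
  case True
  \<comment> \<open>Breaker takes the empty set, which is all that is left.\<close>
  then show ?thesis by (auto simp: breaker_move_def)
next
  case False
  then obtain e where "e \<in> free_edges G p" by blast
  then have "{e} \<subseteq> free_edges G p \<and> finite {e} \<and> card {e} = 1" by simp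
  then show ?thesis unfolding breaker_move_def by blast
qed

lemma legal_move_exists:
  assumes "\<not> game_over G p"
  shows "\<exists>q. legal_move G 1 p q"
  using assms walker_move_exists[OF assms] breaker_move_exists[of G p]
  by (cases "to_move p") (auto simp: legal_move_def)

section \<open>Moves on the complete graph\<close>

definition unvisited :: "nat \<Rightarrow> nat position \<Rightarrow> nat set" where
  "unvisited n p = {..<n} - visited p"

text \<open>As Walker's edges lie inside the visited set, an edge with an open end is free unless
  Breaker holds it. This is what lets Breaker claim such edges.\<close>

definition valid :: "nat \<Rightarrow> nat position \<Rightarrow> bool" where
  "valid n p \<longleftrightarrow> location p \<in> visited p \<and> visited p \<subseteq> {..<n} \<and>
     walker_edges p \<subseteq> Pow (visited p) \<and> breaker_edges p \<subseteq> edges (complete_graph n)"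

lemma verts_complete_graph [simp]: "verts (complete_graph n) = {..<n}"
  by (simp add: complete_graph_def)

lemma edge_complete_graph_iff [simp]:
  "{x, y} \<in> edges (complete_graph n) \<longleftrightarrow> x < n \<and> y < n \<and> x \<noteq> y"
  by (auto simp: complete_graph_def card_insert_if)

lemma finite_unvisited [simp]: "finite (unvisited n p)"
  by (simp add: unvisited_def)

lemma valid_start: "v < n \<Longrightarrow> valid n (start_position first v)"
  by (simp add: valid_def start_position_def)

lemma card_unvisited_start: "v < n \<Longrightarrow> card (unvisited n (start_position first v)) = n - 1"
  by (simp add: unvisited_def start_position_def)

lemma card_visited_plus_unvisited:
  assumes "valid n p"
  shows "card (visited p) + card (unvisited n p) = n"
proof -
  have "card (visited p \<union> unvisited n p) = card (visited p) + card (unvisited n p)"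
    using assms by (intro card_Un_disjoint) (auto simp: valid_def unvisited_def finite_subset)
  moreover have "visited p \<union> unvisited n p = {..<n}"
    using assms by (auto simp: valid_def unvisited_def)
  ultimately show ?thesis by simp
qed

lemma location_neq_unvisited: "valid n p \<Longrightarrow> x \<in> unvisited n p \<Longrightarrow> x \<noteq> location p"
  by (auto simp: valid_def unvisited_def)

lemma valid_legal_move:
  assumes "valid n p" "legal_move (complete_graph n) \<beta> p q"
  shows "valid n q"
  using assms
  by (cases "to_move p")
    (force simp: valid_def legal_move_def walker_move_def breaker_move_def free_edges_def)+

lemma walker_moveE:
  assumes "legal_move (complete_graph n) \<beta> p q" "to_move p = Walker"
  obtains w where "w \<in> unvisited n p" "{location p, w} \<notin> breaker_edges p" "location q = w"
    "unvisited n q = unvisited n p - {w}" "breaker_edges q = breaker_edges p" "to_move q = Breaker"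
proof -
  from assms obtain w where "w < n" "w \<notin> visited p" "{location p, w} \<notin> breaker_edges p"
    "q = p\<lparr>location := w, visited := insert w (visited p),
       walker_edges := insert {location p, w} (walker_edges p), to_move := Breaker\<rparr>"
    by (auto simp: legal_move_def walker_move_def)
  then show ?thesis by (intro that[of w]) (auto simp: unvisited_def)
qed

lemma walker_moveI:
  assumes "valid n p" "to_move p = Walker" "w \<in> unvisited n p"
    and free: "{location p, w} \<notin> breaker_edges p"
  obtains q where "legal_move (complete_graph n) \<beta> p q" "location q = w"
    "unvisited n q = unvisited n p - {w}" "breaker_edges q = breaker_edges p" "to_move q = Breaker"
proof -
  let ?q = "p\<lparr>location := w, visited := insert w (visited p),
       walker_edges := insert {location p, w} (walker_edges p), to_move := Breaker\<rparr>"
  have w: "w < n" "w \<notin> visited p" "location p < n" "location p \<noteq> w"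
    using assms(1,3) by (auto simp: unvisited_def valid_def)
  then have "\<not> game_over (complete_graph n) p"
    unfolding game_over_def using free by (auto intro!: exI[of _ "[w]"])
  with w free assms(2) have "legal_move (complete_graph n) \<beta> p ?q"
    by (auto simp: legal_move_def walker_move_def)
  then show ?thesis by (rule that) (auto simp: unvisited_def)
qed

lemma breaker_moveE:
  assumes "legal_move (complete_graph n) 1 p q" "to_move p = Breaker"
  obtains F where "card F \<le> 1" "finite F" "breaker_edges q = breaker_edges p \<union> F"
    "location q = location p" "unvisited n q = unvisited n p" "to_move q = Walker"
proof -
  from assms obtain F where F: "finite F" "card F \<le> 1"
    "q = p\<lparr>breaker_edges := breaker_edges p \<union> F, to_move := Walker\<rparr>"
    unfolding legal_move_def breaker_move_def by fastforce
  then show ?thesis by (intro that[of F]) (auto simp: unvisited_def)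
qed

text \<open>The edge \<open>e\<close> may already belong to Breaker, in which case his move is an arbitrary one.\<close>

lemma breaker_moveI:
  assumes "valid n p" "to_move p = Breaker" "\<not> game_over (complete_graph n) p"
    and e: "e \<in> edges (complete_graph n)" "\<not> e \<subseteq> visited p"
  obtains q where "legal_move (complete_graph n) 1 p q"
    "insert e (breaker_edges p) \<subseteq> breaker_edges q"
    "location q = location p" "unvisited n q = unvisited n p" "to_move q = Walker"
proof (cases "e \<in> breaker_edges p")
  case True
  obtain q where q: "legal_move (complete_graph n) 1 p q"
    using legal_move_exists assms(3) by blast
  then obtain F where "breaker_edges q = breaker_edges p \<union> F" "location q = location p"
    "unvisited n q = unvisited n p" "to_move q = Walker"
    using assms(2) by (rule breaker_moveE)
  with True q show ?thesis by (intro that) auto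
next
  case False
  then have "e \<in> free_edges (complete_graph n) p"
    using assms(1) e by (auto simp: free_edges_def valid_def)
  then have "{e} \<subseteq> free_edges (complete_graph n) p \<and> finite {e} \<and> card {e} = 1" by simp
  then have "breaker_move (complete_graph n) 1 p
      (p\<lparr>breaker_edges := breaker_edges p \<union> {e}, to_move := Walker\<rparr>)"
    unfolding breaker_move_def by blast
  then have "legal_move (complete_graph n) 1 p
      (p\<lparr>breaker_edges := breaker_edges p \<union> {e}, to_move := Walker\<rparr>)"
    using assms(2,3) by (simp add: legal_move_def)
  then show ?thesis by (rule that) (auto simp: unvisited_def)
qed

section \<open>Walker's strategy\<close>

text \<open>The edges from \<open>l\<close> to \<open>U\<close> are \<open>card U\<close> distinct
  subsets of \<open>insert l U\<close>, so \<open>B\<close> is too small there to contain all of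
  them.\<close>

lemma unblocked_vertex:
  assumes "finite U" "l \<notin> U" "card (B \<inter> Pow (insert l U)) < card U"
  obtains w where "w \<in> U" "{l, w} \<notin> B"
proof -
  have "inj_on (\<lambda>w. {l, w}) U"
    using assms(2) by (auto simp: inj_on_def doubleton_eq_iff)
  then have "\<not> (\<lambda>w. {l, w}) ` U \<subseteq> B \<inter> Pow (insert l U)"
    using card_inj_on_le[of "\<lambda>w. {l, w}" U "B \<inter> Pow (insert l U)"] assms(1,3) by auto
  then show ?thesis using that by auto
qed

text \<open>An edge of \<open>B\<close> inside \<open>U\<close> is the only one, and removing either
  end from \<open>U\<close> disposes of it. If both ends were blocked from \<open>l\<close>,
  \<open>B\<close> would have three edges inside \<open>insert l U\<close>. If \<open>U\<close>
  contains no edge of \<open>B\<close>, any unblocked vertex will do.\<close>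

lemma unblocked_vertex_cover:
  assumes "finite U" "l \<notin> U" "\<And>e. e \<in> B \<Longrightarrow> card e = 2"
    and "card (B \<inter> Pow U) \<le> 1" "card (B \<inter> Pow (insert l U)) \<le> 2" "3 \<le> card U"
  obtains w where "w \<in> U" "{l, w} \<notin> B" "B \<inter> Pow (U - {w}) = {}"
proof (cases "B \<inter> Pow U = {}")
  case True
  obtain w where "w \<in> U" "{l, w} \<notin> B"
    using unblocked_vertex[of U l B] assms by auto
  with True show ?thesis by (intro that) auto
next
  case False
  then obtain e where e: "B \<inter> Pow U = {e}"
    using assms(1,4) by (metis card_1_singletonE card_0_eq finite_Int finite_Pow_iff le_neq_implies_less less_one)
  then have "card e = 2" using assms(3) by blast
  then obtain y z where yz: "e = {y, z}" "y \<noteq> z" by (meson card_2_iff)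
  with e have U: "y \<in> U" "z \<in> U" by auto
  have "\<not> {{l, y}, {l, z}, e} \<subseteq> B \<inter> Pow (insert l U)"
  proof
    assume "{{l, y}, {l, z}, e} \<subseteq> B \<inter> Pow (insert l U)"
    then have "card {{l, y}, {l, z}, e} \<le> card (B \<inter> Pow (insert l U))"
      using assms(1) by (intro card_mono) auto
    moreover have "card {{l, y}, {l, z}, e} = 3"
      using yz U assms(2) by (auto simp: card_insert_if doubleton_eq_iff)
    ultimately show False using assms(5) by simp
  qed
  then obtain w where "w \<in> {y, z}" "{l, w} \<notin> B"
    using e U yz by auto
  moreover from this have "B \<inter> Pow (U - {w}) = {}"
    using e yz by blast
  ultimately show ?thesis using U that by blast
qed

text \<open>\<open>B \<inter> Pow V\<close> counts the Breaker edges between open vertices together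
  with those from the location to them. The bounds before Walker's move allow for one more edge, the
  one Breaker has just taken. With at most two open vertices the target is reached and nothing more
  is asked.\<close>

definition walker_invariant :: "nat \<Rightarrow> nat position \<Rightarrow> bool" where
  "walker_invariant n p \<longleftrightarrow> valid n p \<and>
     (let U = unvisited n p; B = breaker_edges p; V = insert (location p) U in
        card U \<le> 2 \<or>
        (case to_move p of
           Breaker \<Rightarrow> B \<inter> Pow U = {} \<and> card (B \<inter> Pow V) \<le> 1
         | Walker \<Rightarrow> card (B \<inter> Pow U) \<le> 1 \<and> card (B \<inter> Pow V) \<le> 2))"

text \<open>Whoever is to move, three open vertices would exceed the number of Breaker edges that
  can block them, so a path of one edge would continue the game.\<close>

lemma walker_invariant_over:
  assumes "walker_invariant n p" "game_over (complete_graph n) p"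
  shows "n - 2 \<le> card (visited p)"
proof (rule ccontr)
  assume "\<not> ?thesis"
  moreover have valid: "valid n p" using assms(1) by (simp add: walker_invariant_def)
  ultimately have 3: "3 \<le> card (unvisited n p)"
    using card_visited_plus_unvisited by fastforce
  with assms(1) have "card (breaker_edges p \<inter> Pow (insert (location p) (unvisited n p)))
      < card (unvisited n p)"
    by (auto simp: walker_invariant_def Let_def split: player.splits)
  then obtain w where w: "w \<in> unvisited n p" "{location p, w} \<notin> breaker_edges p"
    by (rule unblocked_vertex[rotated 2]) (use valid in \<open>auto simp: valid_def unvisited_def\<close>)
  moreover have "location p < n" "location p \<noteq> w"
    using valid w location_neq_unvisited by (auto simp: valid_def)
  ultimately have "\<not> game_over (complete_graph n) p"
    unfolding game_over_def by (auto simp: unvisited_def intro!: exI[of _ "[w]"])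
  with assms(2) show False by contradiction
qed

text \<open>With three or more open vertices Walker moves to the vertex from
  \<open>unblocked_vertex_cover\<close>. After that any legal move will do, since the open set only
  shrinks.\<close>

lemma walker_invariant_own:
  assumes inv: "walker_invariant n p" and turn: "to_move p = Walker"
    and not_over: "\<not> game_over (complete_graph n) p"
  shows "\<exists>q. legal_move (complete_graph n) 1 p q \<and> walker_invariant n q"
proof (cases "card (unvisited n p) \<le> 2")
  case True
  obtain q where q: "legal_move (complete_graph n) 1 p q"
    using legal_move_exists not_over by blast
  obtain w where "unvisited n q = unvisited n p - {w}"
    using walker_moveE[OF q turn] by metis
  then have "card (unvisited n q) \<le> 2"
    using True card_Diff1_le[of "unvisited n p" w] by simp
  then show ?thesis
    using q inv valid_legal_move by (auto simp: walker_invariant_def)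
next
  case False
  let ?U = "unvisited n p" and ?B = "breaker_edges p"
  have valid: "valid n p" using inv by (simp add: walker_invariant_def)
  have bounds: "card (?B \<inter> Pow ?U) \<le> 1" "card (?B \<inter> Pow (insert (location p) ?U)) \<le> 2"
    using inv turn False by (auto simp: walker_invariant_def Let_def)
  obtain w where w: "w \<in> ?U" "{location p, w} \<notin> ?B" "?B \<inter> Pow (?U - {w}) = {}"
  proof (rule unblocked_vertex_cover[OF _ _ _ bounds])
    show "card e = 2" if "e \<in> ?B" for e
      using valid that by (auto simp: valid_def complete_graph_def)
  qed (use False valid in \<open>auto simp: valid_def unvisited_def\<close>)
  obtain q where q: "legal_move (complete_graph n) 1 p q" "location q = w"
    "unvisited n q = ?U - {w}" "breaker_edges q = ?B" "to_move q = Breaker"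
    using walker_moveI[OF valid turn w(1,2)] by metis
  \<comment> \<open>The new location and the new open set together form the old open set, so the old
    bound for \<open>?U\<close> becomes the new bound for \<open>V\<close>.\<close>
  have "walker_invariant n q"
    using valid_legal_move[OF valid q(1)] q w bounds
    by (simp add: walker_invariant_def insert_absorb)
  with q(1) show ?thesis by blast
qed

text \<open>Breaker's one edge raises each of the two counts by at most one, from 0 to 1 and from 1
  to 2.\<close>

lemma walker_invariant_other:
  assumes inv: "walker_invariant n p" and turn: "to_move p \<noteq> Walker"
    and move: "legal_move (complete_graph n) 1 p q"
  shows "walker_invariant n q"
proof -
  have turn': "to_move p = Breaker" using turn by (cases "to_move p") auto
  obtain F where F: "card F \<le> 1" "finite F" "breaker_edges q = breaker_edges p \<union> F"
    "location q = location p" "unvisited n q = unvisited n p" "to_move q = Walker"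
    using breaker_moveE[OF move turn'] by metis
  have bound: "card (breaker_edges q \<inter> X) \<le> card (breaker_edges p \<inter> X) + 1" for X
  proof -
    have "card (breaker_edges q \<inter> X) \<le> card (breaker_edges p \<inter> X) + card (F \<inter> X)"
      by (simp add: F(3) Int_Un_distrib2 card_Un_le)
    also have "card (F \<inter> X) \<le> 1"
      using F(1,2) card_mono[of F "F \<inter> X"] by auto
    finally show ?thesis by simp
  qed
  have "valid n q" using inv move valid_legal_move by (auto simp: walker_invariant_def)
  then show ?thesis
    using inv turn' F(4-6) bound[of "Pow (unvisited n p)"]
      bound[of "Pow (insert (location p) (unvisited n p))"]
    by (auto simp: walker_invariant_def Let_def)
qed

lemma walker_guarantees_complete_graph:
  assumes "v < n"
  shows "walker_guarantees (complete_graph n) 1 (start_position first v) (n - 2)"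
proof -
  have "walker_invariant n (start_position first v)"
    using valid_start[OF assms]
    by (cases first) (auto simp: walker_invariant_def start_position_def)
  then have "\<exists>\<sigma>. legal_strategy (complete_graph n) 1 (start_position first v) Walker \<sigma> \<and>
      (\<forall>ps. partial_play (complete_graph n) 1 (start_position first v) ps \<and> follows Walker \<sigma> ps
        \<longrightarrow> walker_invariant n (last ps))"
    using walker_invariant_own walker_invariant_other legal_move_exists
    by (rule invariant_strategy)
  then show ?thesis
    unfolding walker_guarantees_def complete_play_def using walker_invariant_over by blast
qed

section \<open>Breaker's strategy\<close>

text \<open>The disjuncts are the stages of the endgame, and each keeps at least two vertices open.
  With three open vertices and Walker to move, \<open>{l, x}\<close> and \<open>{y, z}\<close> form
  the perfect matching. With two, both are blocked and Walker is stuck.\<close>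

definition breaker_invariant :: "nat \<Rightarrow> nat position \<Rightarrow> bool" where
  "breaker_invariant n p \<longleftrightarrow> valid n p \<and>
     (let U = unvisited n p; B = breaker_edges p; l = location p in
        case to_move p of
          Breaker \<Rightarrow> card U \<ge> 4 \<or>
            card U = 3 \<and> (\<exists>e \<in> B. e \<subseteq> insert l U) \<or>
            card U = 2 \<and> (\<exists>x \<in> U. {l, x} \<in> B)
        | Walker \<Rightarrow> card U \<ge> 5 \<or>
            card U = 4 \<and> (\<exists>e \<in> B. e \<subseteq> U) \<or>
            (\<exists>x y z. U = {x, y, z} \<and> card U = 3 \<and> {l, x} \<in> B \<and> {y, z} \<in> B) \<or>
            card U = 2 \<and> (\<forall>x \<in> U. {l, x} \<in> B))"

lemma breaker_invariant_card:
  assumes "breaker_invariant n p"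
  shows "card (visited p) \<le> n - 2"
proof -
  have "card (unvisited n p) \<ge> 2"
    using assms by (cases "to_move p") (auto simp: breaker_invariant_def Let_def)
  moreover have "valid n p" using assms by (simp add: breaker_invariant_def)
  ultimately show ?thesis using card_visited_plus_unvisited by fastforce
qed

text \<open>An edge inside four open vertices stays inside the location and the three that remain.
  Against the matching, Walker must step to \<open>y\<close> or \<open>z\<close>, whose partner is
  then blocked. With two open vertices, both blocked, she has no move.\<close>

lemma breaker_invariant_other:
  assumes inv: "breaker_invariant n p" and turn: "to_move p \<noteq> Breaker"
    and move: "legal_move (complete_graph n) 1 p q"
  shows "breaker_invariant n q"
proof -
  let ?U = "unvisited n p" and ?B = "breaker_edges p"
  have turn': "to_move p = Walker" using turn by (cases "to_move p") auto
  have valid: "valid n p" using inv by (simp add: breaker_invariant_def)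
  obtain w where w: "w \<in> ?U" "{location p, w} \<notin> ?B"
    and q: "location q = w" "unvisited n q = ?U - {w}" "breaker_edges q = ?B" "to_move q = Breaker"
    using walker_moveE[OF move turn'] by metis
  have card: "card (unvisited n q) = card ?U - 1"
    using w(1) q(2) by simp
  have U: "insert w (unvisited n q) = ?U"
    using w(1) q(2) by auto
  from inv turn' consider "card ?U \<ge> 5" | e where "card ?U = 4" "e \<in> ?B" "e \<subseteq> ?U"
    | x y z where "?U = {x, y, z}" "card ?U = 3" "{location p, x} \<in> ?B" "{y, z} \<in> ?B"
    | "card ?U = 2" "\<forall>x \<in> ?U. {location p, x} \<in> ?B"
    by (auto simp: breaker_invariant_def Let_def)
  then have "card (unvisited n q) \<ge> 4 \<or>
      card (unvisited n q) = 3 \<and> (\<exists>e \<in> ?B. e \<subseteq> insert w (unvisited n q)) \<or>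
      card (unvisited n q) = 2 \<and> (\<exists>x \<in> unvisited n q. {w, x} \<in> ?B)"
  proof cases
    case 3
    \<comment> \<open>Otherwise the partner of \<open>w\<close> would be \<open>w\<close> itself and
      no longer open.\<close>
    then have "y \<noteq> z" by (auto simp: card_insert_if split: if_splits)
    have "w = y \<or> w = z" using 3 w by auto
    with 3 \<open>y \<noteq> z\<close> have "\<exists>x \<in> unvisited n q. {w, x} \<in> ?B"
      by (auto simp: q(2) insert_commute)
    with card 3(2) show ?thesis by simp
  qed (use card U w in auto)
  then show ?thesis
    using valid_legal_move[OF valid move] q by (simp add: breaker_invariant_def)
qed

lemma breaker_invariant_own:
  assumes inv: "breaker_invariant n p" and turn: "to_move p = Breaker"
    and not_over: "\<not> game_over (complete_graph n) p"
  shows "\<exists>q. legal_move (complete_graph n) 1 p q \<and> breaker_invariant n q"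
proof -
  let ?U = "unvisited n p" and ?B = "breaker_edges p" and ?l = "location p"
  have valid: "valid n p" using inv by (simp add: breaker_invariant_def)
  have l: "?l \<notin> ?U" "?l < n" and less: "\<And>x. x \<in> ?U \<Longrightarrow> x < n" "\<And>x. x \<in> ?U \<Longrightarrow> x \<notin> visited p"
    using valid by (auto simp: valid_def unvisited_def)
  \<comment> \<open>The condition for Walker's turn as a function of Breaker's edges alone, since
    his move changes neither location nor open set. It is monotone, so it suffices to find one edge
    \<open>e\<close> that makes \<open>insert e ?B\<close> good.\<close>
  define good where "good B \<longleftrightarrow> card ?U \<ge> 5 \<or> card ?U = 4 \<and> (\<exists>e \<in> B. e \<subseteq> ?U) \<or>
      (\<exists>x y z. ?U = {x, y, z} \<and> card ?U = 3 \<and> {?l, x} \<in> B \<and> {y, z} \<in> B) \<or>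
      card ?U = 2 \<and> (\<forall>x \<in> ?U. {?l, x} \<in> B)" for B
  have good_mono: "good B'" if "good B" "B \<subseteq> B'" for B B'
    using that unfolding good_def by blast
  have edgeI: "{a, b} \<in> edges (complete_graph n) \<and> \<not> {a, b} \<subseteq> visited p"
    if "a \<in> insert ?l ?U" "b \<in> ?U" "a \<noteq> b" for a b
    using that l less by auto
  from inv turn consider "card ?U \<ge> 4" | e where "card ?U = 3" "e \<in> ?B" "e \<subseteq> insert ?l ?U"
    | x where "card ?U = 2" "x \<in> ?U" "{?l, x} \<in> ?B"
    by (auto simp: breaker_invariant_def Let_def)
  then have "\<exists>e. e \<in> edges (complete_graph n) \<and> \<not> e \<subseteq> visited p \<and> good (insert e ?B)"
  proof cases
    case 1
    then have "\<not> card ?U \<le> Suc 0" by simp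
    then obtain a b where "a \<in> ?U" "b \<in> ?U" "a \<noteq> b"
      by (auto simp: card_le_Suc0_iff_eq)
    \<comment> \<open>Any edge between open vertices serves: with exactly four it starts the
      endgame, with more it is an arbitrary move.\<close>
    then have "\<exists>e \<in> insert {a, b} ?B. e \<subseteq> ?U" by simp
    moreover have "card ?U \<ge> 5 \<or> card ?U = 4" using 1 by arith
    ultimately have "good (insert {a, b} ?B)" unfolding good_def by blast
    with edgeI[of a b] \<open>a \<in> ?U\<close> \<open>b \<in> ?U\<close> \<open>a \<noteq> b\<close> show ?thesis by blast
  next
    case 2
    have "card e = 2"
      using valid 2(2) by (auto simp: valid_def complete_graph_def)
    show ?thesis
    proof (cases "?l \<in> e")
      case True
      then obtain x where x: "e = {?l, x}" "x \<noteq> ?l"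
        using \<open>card e = 2\<close> by (auto simp: card_2_iff)
      with 2 have "x \<in> ?U" by auto
      with 2(1) have "card (?U - {x}) = 2" by simp
      \<comment> \<open>The missing matching edge joins the two open vertices outside
        \<open>e\<close>.\<close>
      then obtain y z where yz: "?U - {x} = {y, z}" "y \<noteq> z" by (meson card_2_iff)
      then have "?U = {x, y, z}" using \<open>x \<in> ?U\<close> by blast
      moreover have "{?l, x} \<in> insert {y, z} ?B" using 2(2) x(1) by simp
      ultimately have "good (insert {y, z} ?B)"
        using 2(1) unfolding good_def by blast
      moreover have "y \<in> ?U" "z \<in> ?U" using yz by auto
      ultimately show ?thesis using edgeI[of y z] yz(2) by blast
    next
      case False
      with 2(3) have "e \<subseteq> ?U" by blast
      obtain y z where yz: "e = {y, z}" "y \<noteq> z" using \<open>card e = 2\<close> by (meson card_2_iff)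
      \<comment> \<open>Here the missing matching edge joins the location to the one open vertex
        outside \<open>e\<close>.\<close>
      have "card (?U - e) = 1"
        using \<open>e \<subseteq> ?U\<close> \<open>card e = 2\<close> 2(1) by (simp add: card_Diff_subset finite_subset)
      then obtain x where x: "?U - e = {x}" by (meson card_1_singletonE)
      then have "?U = {x, y, z}" using \<open>e \<subseteq> ?U\<close> yz by blast
      moreover have "{y, z} \<in> insert {?l, x} ?B" using 2(2) yz(1) by simp
      ultimately have "good (insert {?l, x} ?B)"
        using 2(1) unfolding good_def by blast
      moreover have "x \<in> ?U" using x by auto
      ultimately show ?thesis using edgeI[of ?l x] l by blast
    qed
  next
    case 3
    then have "card (?U - {x}) = 1" by simp
    then obtain y where "?U - {x} = {y}" by (meson card_1_singletonE)
    then have U: "?U = {x, y}" using 3(2) by blast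
    then have "\<forall>z \<in> ?U. {?l, z} \<in> insert {?l, y} ?B" using 3(3) by simp
    then have "good (insert {?l, y} ?B)" using 3(1) unfolding good_def by blast
    then show ?thesis using edgeI[of ?l y] l U by blast
  qed
  then obtain e where e: "e \<in> edges (complete_graph n)" "\<not> e \<subseteq> visited p" "good (insert e ?B)"
    by blast
  obtain q where q: "legal_move (complete_graph n) 1 p q" "insert e ?B \<subseteq> breaker_edges q"
    "location q = ?l" "unvisited n q = ?U" "to_move q = Walker"
    using breaker_moveI[OF valid turn not_over e(1,2)] by metis
  have "good (breaker_edges q)" using good_mono e(3) q(2) by blast
  then have "breaker_invariant n q"
    using valid_legal_move[OF valid q(1)] q(3-5) by (simp add: breaker_invariant_def good_def)
  with q(1) show ?thesis by blast
qed

lemma breaker_guarantees_complete_graph: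
  assumes "n > 5" "v < n"
  shows "breaker_guarantees (complete_graph n) 1 (start_position first v) (n - 2)"
proof -
  \<comment> \<open>\<open>n > 5\<close> leaves at least five open vertices, the threshold for
    Walker's turn, so Breaker is in time even if Walker begins.\<close>
  have "breaker_invariant n (start_position first v)"
    using valid_start[OF assms(2)] card_unvisited_start[OF assms(2)] assms(1)
    by (cases first) (auto simp: breaker_invariant_def Let_def start_position_def)
  then have "\<exists>\<sigma>. legal_strategy (complete_graph n) 1 (start_position first v) Breaker \<sigma> \<and>
      (\<forall>ps. partial_play (complete_graph n) 1 (start_position first v) ps \<and> follows Breaker \<sigma> ps
        \<longrightarrow> breaker_invariant n (last ps))"
    using breaker_invariant_own breaker_invariant_other legal_move_exists
    by (rule invariant_strategy)
  then show ?thesis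
    unfolding breaker_guarantees_def complete_play_def using breaker_invariant_card by blast
qed

theorem theorem1:
  fixes n v :: nat and first :: player
  assumes "n > 5" and "v < n"
  shows "optimal_visits (complete_graph n) 1 first v (n - 2)"
  using walker_guarantees_complete_graph[OF assms(2)] breaker_guarantees_complete_graph[OF assms]
  by (simp add: optimal_visits_def)

end
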